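(* For a skew monoidal monoid $\mathcal A=\langle A,T,Q,\gamma,\eta,\varepsilon\rangle$ the following conditions are equivalent: (i) $\mathcal A$ is right closed, i.e., $T:A\to A$ has a right adjoint in the 2-category $\mathbf{Mon}$. (ii) The right internal hom $[R,R]^r\cong A_{T(A)}$ belongs to $\mathcal M_1$, i.e., $A$ is rank 1 free as right $A$-module via $T$. (iii) $F$ is rank 1 free as a right $A$-module with action $f\cdot a=S(a)f$. Also, the following conditions are equivalent: (i) $\mathcal A$ is left closed, i.e., $Q:A\to A$ has a right adjoint in the 2-category $\mathbf{Mon}$. (ii) The left internal hom $[R,R]^\ell\cong A_{Q(A)}$ belongs to $\mathcal M_1$, i.e., $A$ is rank 1 free as right $A$-module via $Q$. (iii) $G$ is a rank 1 free right $A$-module with action $g\cdot a=g\,T(Q(a))$.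
   Context: A skew monoidal monoid $\mathcal A=\langle A,T,Q,\gamma,\eta,\varepsilon\rangle$ consists of a monoid $A$, monoid endomorphisms $T,Q:A\to A$ and elements $\gamma,\eta,\varepsilon\in A$ such that for all $a,b\in A$: $T(a)Q(b)=Q(b)T(a)$, $\gamma T^2(a)=T(a)\gamma$, $\gamma TQ(a)=QT(a)\gamma$, $\gamma Q(a)=Q^2(a)\gamma$, $\eta a=T(a)\eta$, $a\varepsilon=\varepsilon Q(a)$, $Q(\gamma)\gamma T(\gamma)=\gamma^2$, $\gamma\eta=Q(\eta)$, $\varepsilon\gamma=T(\varepsilon)$, $Q(\varepsilon)\gamma T(\eta)=1$, $\varepsilon\eta=1$. Put $\mu:=Q(\varepsilon)\gamma$, $\delta:=\gamma T(\eta)$ and $S:A\to A^{\mathrm{op}}$, $S(a):=\mu T(Q(a)\eta)$, a monoid morphism. The sets $G:=\mu T(A)$ and $F:=Q(A)\delta$ are submonoids of $A$ containing $S(A)$; moreover $T(A)\subset G$ and $Q(A)\subset F$. $\mathbf{Mon}$ is the 2-category with objects monoids, 1-cells monoid homomorphisms $f:A\to B$, and 2-cells $b:f\to g:A\to B$ the elements $b\in B$ with $bf(a)=g(a)b$ for all $a\in A$. Regarded as a one-object skew monoidal category with product $a*b=Q(a)T(b)$, $\mathcal A$ is right (left) closed if tensoring on the left (right) with its object, i.e. the endofunctor $T=1*(-)$ (resp. $Q=(-)*1$), has a right adjoint. $\mathcal M$ is the category of right $A$-modules ($=$ right $A$-sets), $R=A_A$ is the right regular module, and $\mathcal M_1\subset\mathcal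 M$ is the full subcategory of rank 1 free modules (those isomorphic to $A_A$). For $M,N\in\mathcal M$, $M\circledast N$ is the quotient of $M\times N\times G$ by the equivalence relation generated by $\langle m\cdot b,n\cdot a,g\rangle\sim\langle m,n,T(a)gS(b)\rangle$ ($a,b\in A$), with right action $[m,n,g]\cdot a=[m,n,gT(a)]$. The right internal hom $[M,-]^r$ is the right adjoint of $M\circledast-$ and the left internal hom $[M,-]^\ell$ is the right adjoint of $-\circledast M$ on $\mathcal M$. $A_{T(A)}$ (resp. $A_{Q(A)}$) denotes the set $A$ with right $A$-action $\langle b,a\rangle\mapsto bT(a)$ (resp. $bQ(a)$). *)

theory Defs
  imports "HOL-Library.FuncSet"
begin

section \<open>The 2-category of monoids\<close>

text \<open>
  A monoid is a type of class \<open>monoid_mult\<close>. Vertical composition of 2-cells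
  \<open>b : f \<rightarrow> g\<close> and \<open>c : g \<rightarrow> h\<close> is the product \<open>c * b\<close>; whiskering \<open>b\<close> with a 1-cell \<open>k\<close>
  gives \<open>k b\<close> on the left, and \<open>b\<close> itself on the right.
\<close>

definition mon_hom :: "('a::monoid_mult \<Rightarrow> 'b::monoid_mult) \<Rightarrow> bool" where
  "mon_hom f \<longleftrightarrow> f 1 = 1 \<and> (\<forall>a b. f (a * b) = f a * f b)"

definition mon_2cell ::
  "'b::monoid_mult \<Rightarrow> ('a::monoid_mult \<Rightarrow> 'b) \<Rightarrow> ('a \<Rightarrow> 'b) \<Rightarrow> bool" where
  "mon_2cell b f g \<longleftrightarrow> mon_hom f \<and> mon_hom g \<and> (\<forall>a. b * f a = g a * b)"

text \<open>
  The adjunction \<open>f \<stileturn> u\<close> with unit \<open>i : 1 \<rightarrow> u f\<close> and counit \<open>e : f u \<rightarrow> 1\<close>; the last two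
  conjuncts are the triangle identities.
\<close>

definition mon_adjunction ::
  "('a::monoid_mult \<Rightarrow> 'b::monoid_mult) \<Rightarrow> ('b \<Rightarrow> 'a) \<Rightarrow> 'a \<Rightarrow> 'b \<Rightarrow> bool" where
  "mon_adjunction f u i e \<longleftrightarrow>
     mon_hom f \<and> mon_hom u \<and>
     mon_2cell i (\<lambda>a. a) (u \<circ> f) \<and> mon_2cell e (f \<circ> u) (\<lambda>b. b) \<and>
     e * f i = 1 \<and> u e * i = 1"

definition has_right_adjoint_Mon :: "('a::monoid_mult \<Rightarrow> 'b::monoid_mult) \<Rightarrow> bool" where
  "has_right_adjoint_Mon f \<longleftrightarrow> (\<exists>u i e. mon_adjunction f u i e)"


section \<open>Skew monoidal monoids\<close>

record 'a smm =
  endT :: "'a \<Rightarrow> 'a"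
  endQ :: "'a \<Rightarrow> 'a"
  gam :: 'a
  eta :: 'a
  eps :: 'a

definition skew_monoidal_monoid :: "'a::monoid_mult smm \<Rightarrow> bool" where
  "skew_monoidal_monoid \<A> \<longleftrightarrow>
     (let T = endT \<A>; Q = endQ \<A>; \<gamma> = gam \<A>; \<eta> = eta \<A>; \<epsilon> = eps \<A> in
        mon_hom T \<and> mon_hom Q \<and>
        (\<forall>a b. T a * Q b = Q b * T a) \<and>
        (\<forall>a. \<gamma> * T (T a) = T a * \<gamma>) \<and>
        (\<forall>a. \<gamma> * T (Q a) = Q (T a) * \<gamma>) \<and>
        (\<forall>a. \<gamma> * Q a = Q (Q a) * \<gamma>) \<and>
        (\<forall>a. \<eta> * a = T a * \<eta>) \<and>
        (\<forall>a. a * \<epsilon> = \<epsilon> * Q a) \<and>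
        Q \<gamma> * \<gamma> * T \<gamma> = \<gamma> * \<gamma> \<and>
        \<gamma> * \<eta> = Q \<eta> \<and>
        \<epsilon> * \<gamma> = T \<epsilon> \<and>
        Q \<epsilon> * \<gamma> * T \<eta> = 1 \<and>
        \<epsilon> * \<eta> = 1)"

text \<open>The skew monoidal product on arrows of the one-object category \<open>A\<close>.\<close>

definition skew_prod :: "'a::monoid_mult smm \<Rightarrow> 'a \<Rightarrow> 'a \<Rightarrow> 'a" where
  "skew_prod \<A> a b = endQ \<A> a * endT \<A> b"

text \<open>
  Functors and natural transformations between one-object categories are the 1-cells and 2-cells
  between the corresponding monoids, so adjunctions of such functors are adjunctions of monoids.
\<close>

definition right_closed :: "'a::monoid_mult smm \<Rightarrow> bool" where
  "right_closed \<A> \<longleftrightarrow> has_right_adjoint_Mon (\<lambda>b. skew_prod \<A> 1 b)"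

definition left_closed :: "'a::monoid_mult smm \<Rightarrow> bool" where
  "left_closed \<A> \<longleftrightarrow> has_right_adjoint_Mon (\<lambda>a. skew_prod \<A> a 1)"

definition smm_mu :: "'a::monoid_mult smm \<Rightarrow> 'a" where
  "smm_mu \<A> = endQ \<A> (eps \<A>) * gam \<A>"

definition smm_delta :: "'a::monoid_mult smm \<Rightarrow> 'a" where
  "smm_delta \<A> = gam \<A> * endT \<A> (eta \<A>)"

definition smm_S :: "'a::monoid_mult smm \<Rightarrow> 'a \<Rightarrow> 'a" where
  "smm_S \<A> a = smm_mu \<A> * endT \<A> (endQ \<A> a * eta \<A>)"

definition smm_G :: "'a::monoid_mult smm \<Rightarrow> 'a set" where
  "smm_G \<A> = {smm_mu \<A> * endT \<A> a | a. True}"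

definition smm_F :: "'a::monoid_mult smm \<Rightarrow> 'a set" where
  "smm_F \<A> = {endQ \<A> a * smm_delta \<A> | a. True}"


section \<open>Right modules\<close>

record ('a, 'm) rmodule =
  elts :: "'m set"
  act :: "'m \<Rightarrow> 'a \<Rightarrow> 'm"

definition right_module :: "('a::monoid_mult, 'm) rmodule \<Rightarrow> bool" where
  "right_module M \<longleftrightarrow>
     (\<forall>m\<in>elts M. \<forall>a. act M m a \<in> elts M) \<and>
     (\<forall>m\<in>elts M. act M m 1 = m) \<and>
     (\<forall>m\<in>elts M. \<forall>a b. act M (act M m a) b = act M m (a * b))"

text \<open>Homomorphisms are extensional, so that equality of homomorphisms is equality of functions.\<close>

definition module_Hom ::
  "('a::monoid_mult, 'm) rmodule \<Rightarrow> ('a, 'n) rmodule \<Rightarrow> ('m \<Rightarrow> 'n) set" where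
  "module_Hom M N =
     {f \<in> elts M \<rightarrow>\<^sub>E elts N. \<forall>m\<in>elts M. \<forall>a. f (act M m a) = act N (f m) a}"

definition module_iso ::
  "('a::monoid_mult, 'm) rmodule \<Rightarrow> ('a, 'n) rmodule \<Rightarrow> bool" where
  "module_iso M N \<longleftrightarrow> (\<exists>f\<in>module_Hom M N. bij_betw f (elts M) (elts N))"

definition regular_module :: "('a::monoid_mult, 'a) rmodule" where
  "regular_module = \<lparr>elts = UNIV, act = (\<lambda>b a. b * a)\<rparr>"

definition via_module :: "('a::monoid_mult \<Rightarrow> 'a) \<Rightarrow> ('a, 'a) rmodule" where
  "via_module h = \<lparr>elts = UNIV, act = (\<lambda>b a. b * h a)\<rparr>"

text \<open>Membership in the full subcategory \<open>\<M>\<^sub>1\<close>.\<close>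

definition rank1_free :: "('a::monoid_mult, 'm) rmodule \<Rightarrow> bool" where
  "rank1_free M \<longleftrightarrow> right_module M \<and> module_iso M (regular_module :: ('a, 'a) rmodule)"

definition F_module :: "'a::monoid_mult smm \<Rightarrow> ('a, 'a) rmodule" where
  "F_module \<A> = \<lparr>elts = smm_F \<A>, act = (\<lambda>f a. smm_S \<A> a * f)\<rparr>"

definition G_module :: "'a::monoid_mult smm \<Rightarrow> ('a, 'a) rmodule" where
  "G_module \<A> = \<lparr>elts = smm_G \<A>, act = (\<lambda>g a. g * endT \<A> (endQ \<A> a))\<rparr>"


section \<open>The skew monoidal product of modules\<close>

inductive tensor_step ::
  "'a::monoid_mult smm \<Rightarrow> ('a, 'm) rmodule \<Rightarrow> ('a, 'n) rmodule \<Rightarrow>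
   'm \<times> 'n \<times> 'a \<Rightarrow> 'm \<times> 'n \<times> 'a \<Rightarrow> bool"
  for \<A> M N where
  "m \<in> elts M \<Longrightarrow> n \<in> elts N \<Longrightarrow> g \<in> smm_G \<A> \<Longrightarrow>
   tensor_step \<A> M N (act M m b, act N n a, g) (m, n, endT \<A> a * g * smm_S \<A> b)"

text \<open>
  The class \<open>[m, n, g]\<close>. A step relates two triples of \<open>M \<times> N \<times> G\<close>, so the class of such a
  triple stays inside \<open>M \<times> N \<times> G\<close>.
\<close>

definition tensor_class ::
  "'a::monoid_mult smm \<Rightarrow> ('a, 'm) rmodule \<Rightarrow> ('a, 'n) rmodule \<Rightarrow>
   'm \<times> 'n \<times> 'a \<Rightarrow> ('m \<times> 'n \<times> 'a) set" where
  "tensor_class \<A> M N p = {q. equivclp (tensor_step \<A> M N) p q}"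

text \<open>
  The unions below run over all representatives of a class, each of which contributes the same
  class.
\<close>

definition tensor ::
  "'a::monoid_mult smm \<Rightarrow> ('a, 'm) rmodule \<Rightarrow> ('a, 'n) rmodule \<Rightarrow>
   ('a, ('m \<times> 'n \<times> 'a) set) rmodule" where
  "tensor \<A> M N =
     \<lparr>elts = tensor_class \<A> M N ` (elts M \<times> elts N \<times> smm_G \<A>),
      act = (\<lambda>c a. \<Union>(m, n, g)\<in>c. tensor_class \<A> M N (m, n, g * endT \<A> a))\<rparr>"

text \<open>The action \<open>[m, n, g] \<mapsto> [p m, q n, g]\<close> of the product on \<open>p : M \<rightarrow> M'\<close> and \<open>q : N \<rightarrow> N'\<close>.\<close>

definition tensor_map ::
  "'a::monoid_mult smm \<Rightarrow> ('a, 'm) rmodule \<Rightarrow> ('a, 'n) rmodule \<Rightarrow>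
   ('a, 'k) rmodule \<Rightarrow> ('a, 'l) rmodule \<Rightarrow> ('m \<Rightarrow> 'k) \<Rightarrow> ('n \<Rightarrow> 'l) \<Rightarrow>
   ('m \<times> 'n \<times> 'a) set \<Rightarrow> ('k \<times> 'l \<times> 'a) set" where
  "tensor_map \<A> M N M' N' p q =
     (\<lambda>c\<in>elts (tensor \<A> M N). \<Union>(m, n, g)\<in>c. tensor_class \<A> M' N' (p m, q n, g))"

abbreviation module_id :: "('a::monoid_mult, 'm) rmodule \<Rightarrow> 'm \<Rightarrow> 'm" where
  "module_id M \<equiv> (\<lambda>m\<in>elts M. m)"


section \<open>Internal homs\<close>

text \<open>
  The value at \<open>N\<close> of a right adjoint of an endofunctor \<open>\<Phi>\<close> of \<open>\<M>\<close>, together with the component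
  at \<open>N\<close> of the counit, is a universal arrow from \<open>\<Phi>\<close> to \<open>N\<close>: a module \<open>H\<close> with
  \<open>ev : \<Phi> H \<rightarrow> N\<close> through which every \<open>f : \<Phi> X \<rightarrow> N\<close> factors as \<open>ev \<circ> \<Phi> k\<close> for a unique
  \<open>k : X \<rightarrow> H\<close>. Here \<open>\<Phi>\<close> is \<open>M \<circledast> -\<close> for the right internal hom and \<open>- \<circledast> M\<close> for the left one.

  A formula cannot quantify over types, so the type carrying the modules \<open>X\<close> is a parameter.
  In a conclusion, a free type variable there gives the property for modules on every type.
  In a hypothesis, the type of \<open>A\<close> is enough: it carries the generator \<open>A\<^sub>A\<close> of \<open>\<M>\<close>.
\<close>

definition is_right_internal_hom ::
  "'x itself \<Rightarrow> 'a::monoid_mult smm \<Rightarrow> ('a, 'm) rmodule \<Rightarrow> ('a, 'n) rmodule \<Rightarrow>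
   ('a, 'h) rmodule \<Rightarrow> (('m \<times> 'h \<times> 'a) set \<Rightarrow> 'n) \<Rightarrow> bool" where
  "is_right_internal_hom _ \<A> M N H ev \<longleftrightarrow>
     right_module H \<and> ev \<in> module_Hom (tensor \<A> M H) N \<and>
     (\<forall>X :: ('a, 'x) rmodule. right_module X \<longrightarrow>
        (\<forall>f\<in>module_Hom (tensor \<A> M X) N.
           \<exists>!k. k \<in> module_Hom X H \<and>
             compose (elts (tensor \<A> M X)) ev (tensor_map \<A> M X M H (module_id M) k) = f))"

definition is_left_internal_hom ::
  "'x itself \<Rightarrow> 'a::monoid_mult smm \<Rightarrow> ('a, 'm) rmodule \<Rightarrow> ('a, 'n) rmodule \<Rightarrow>
   ('a, 'h) rmodule \<Rightarrow> (('h \<times> 'm \<times> 'a) set \<Rightarrow> 'n) \<Rightarrow> bool" where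
  "is_left_internal_hom _ \<A> M N H ev \<longleftrightarrow>
     right_module H \<and> ev \<in> module_Hom (tensor \<A> H M) N \<and>
     (\<forall>X :: ('a, 'x) rmodule. right_module X \<longrightarrow>
        (\<forall>f\<in>module_Hom (tensor \<A> X M) N.
           \<exists>!k. k \<in> module_Hom X H \<and>
             compose (elts (tensor \<A> X M)) ev (tensor_map \<A> X M H M k (module_id M)) = f))"

end

theory Submission
  imports Defs
begin

text \<open>
  Write \<open>V\<^sub>T\<close> and \<open>V\<^sub>Q\<close> for \<open>A\<close> as a module via \<open>T\<close> and \<open>Q\<close>. Sending \<open>c\<close> to \<open>\<mu> T(c)\<close>
  identifies \<open>A\<close> with \<open>G\<close>, with inverse \<open>g \<mapsto> g \<eta>\<close>. Hence a homomorphism \<open>f : R \<circledast> X \<rightarrow> R\<close> is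
  determined by \<open>k(x) = f[1, x, \<mu>]\<close>, namely \<open>f[m, x, g] = k(x) Q(m) g \<eta>\<close>, and \<open>k\<close> ranges over all
  homomorphisms \<open>X \<rightarrow> V\<^sub>T\<close>; symmetrically \<open>f[x, m, g] = k(x) T(m) g \<eta>\<close> for \<open>X \<circledast> R \<rightarrow> R\<close> and
  \<open>k : X \<rightarrow> V\<^sub>Q\<close>. So \<open>V\<^sub>T\<close> and \<open>V\<^sub>Q\<close> are the internal homs. A free generator \<open>e\<close> of \<open>A\<close> via an
  endomorphism \<open>h\<close> is the same thing as the counit of an adjunction \<open>h \<stileturn> u\<close>, where \<open>u(b)\<close> solves
  \<open>e h(u(b)) = b e\<close>. Finally \<open>b \<mapsto> Q(b) \<delta>\<close> and \<open>b \<mapsto> \<mu> T(b)\<close> are isomorphisms from \<open>V\<^sub>T\<close> onto \<open>F\<close>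
  and from \<open>V\<^sub>Q\<close> onto \<open>G\<close>.
\<close>

section \<open>Modules over a monoid\<close>

lemma regular_module_simps [simp]:
  "elts (regular_module :: ('a::monoid_mult, 'a) rmodule) = UNIV"
  "act (regular_module :: ('a::monoid_mult, 'a) rmodule) b a = b * a"
  by (simp_all add: regular_module_def)

lemma via_module_simps [simp]:
  "elts (via_module h) = UNIV" "act (via_module h) b a = b * h a"
  by (simp_all add: via_module_def)

lemma right_module_regular: "right_module (regular_module :: ('a::monoid_mult, 'a) rmodule)"
  by (simp add: right_module_def regular_module_def mult.assoc)

lemma right_module_via: "mon_hom h \<Longrightarrow> right_module (via_module h)"
  by (simp add: right_module_def via_module_def mon_hom_def mult.assoc)

lemma module_HomI:
  assumes "\<And>m. m \<in> elts M \<Longrightarrow> f m \<in> elts N"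
    and "\<And>m. m \<notin> elts M \<Longrightarrow> f m = undefined"
    and "\<And>m a. m \<in> elts M \<Longrightarrow> f (act M m a) = act N (f m) a"
  shows "f \<in> module_Hom M N"
  using assms by (auto simp: module_Hom_def PiE_def extensional_def)

lemma module_Hom_mem: "f \<in> module_Hom M N \<Longrightarrow> m \<in> elts M \<Longrightarrow> f m \<in> elts N"
  by (auto simp: module_Hom_def)

lemma module_Hom_act:
  "f \<in> module_Hom M N \<Longrightarrow> m \<in> elts M \<Longrightarrow> f (act M m a) = act N (f m) a"
  by (auto simp: module_Hom_def)

lemma module_Hom_eqI:
  assumes "f \<in> module_Hom M N" "g \<in> module_Hom M N'" "\<And>m. m \<in> elts M \<Longrightarrow> f m = g m"
  shows "f = g"
  by (rule extensionalityI[where A = "elts M"]) (use assms in \<open>auto simp: module_Hom_def PiE_def\<close>)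

lemma right_module_act_mem: "right_module M \<Longrightarrow> m \<in> elts M \<Longrightarrow> act M m a \<in> elts M"
  by (auto simp: right_module_def)

lemma module_id_Hom: "right_module M \<Longrightarrow> module_id M \<in> module_Hom M M"
  by (rule module_HomI) (auto simp: right_module_act_mem)

lemma module_iso_refl: "right_module M \<Longrightarrow> module_iso M M"
  unfolding module_iso_def
  by (rule bexI[OF _ module_id_Hom]) (simp_all add: bij_betw_def inj_on_def)

lemma module_iso_sym:
  assumes M: "right_module M" and iso: "module_iso M N"
  shows "module_iso N M"
proof -
  obtain f where f: "f \<in> module_Hom M N" and b: "bij_betw f (elts M) (elts N)"
    using iso by (auto simp: module_iso_def)
  let ?g = "\<lambda>n\<in>elts N. inv_into (elts M) f n"
  have mem: "inv_into (elts M) f n \<in> elts M" "f (inv_into (elts M) f n) = n" if "n \<in> elts N" for n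
    using b that by (auto simp: bij_betw_def inv_into_into f_inv_into_f)
  have act: "?g (act N n a) = act M (?g n) a" if n: "n \<in> elts N" for n a
  proof -
    have x: "act M (?g n) a \<in> elts M" using M mem n by (simp add: right_module_act_mem)
    have "f (act M (?g n) a) = act N n a"
      using module_Hom_act[OF f mem(1)[OF n]] mem(2)[OF n] n by simp
    with module_Hom_mem[OF f x] b x show ?thesis
      by (metis bij_betw_inv_into_left restrict_apply')
  qed
  have "?g \<in> module_Hom N M" using mem act by (auto intro!: module_HomI)
  moreover have "bij_betw ?g (elts N) (elts M)"
    using bij_betw_inv_into[OF b] by (subst bij_betw_cong[where g = "inv_into (elts M) f"]) auto
  ultimately show ?thesis unfolding module_iso_def by blast
qed

lemma module_iso_trans:
  assumes M: "right_module M" and "module_iso M N" "module_iso N P"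
  shows "module_iso M P"
proof -
  obtain f where f: "f \<in> module_Hom M N" and bf: "bij_betw f (elts M) (elts N)"
    using assms by (auto simp: module_iso_def)
  obtain g where g: "g \<in> module_Hom N P" and bg: "bij_betw g (elts N) (elts P)"
    using assms by (auto simp: module_iso_def)
  have "compose (elts M) g f \<in> module_Hom M P"
    using f g M
    by (auto intro!: module_HomI simp: compose_def module_Hom_mem module_Hom_act right_module_act_mem)
  moreover have "bij_betw (compose (elts M) g f) (elts M) (elts P)"
    using bf bg by (rule bij_betw_compose)
  ultimately show ?thesis by (auto simp: module_iso_def)
qed

text \<open>The axioms transfer along a surjective homomorphism. Thus \<open>F_module\<close> and
  \<open>G_module\<close> become modules through their comparison with \<open>via_module\<close>,
  and closure of \<open>F\<close> and \<open>G\<close> under the actions needs no separate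
  check.\<close>

lemma right_module_iso_image:
  assumes M: "right_module M" and iso: "module_iso M N"
  shows "right_module N"
proof -
  obtain f where f: "f \<in> module_Hom M N" and img: "elts N = f ` elts M"
    using iso by (auto simp: module_iso_def bij_betw_def)
  show ?thesis
    using M unfolding right_module_def img
    by (auto simp: module_Hom_act[OF f, symmetric])
qed

lemma rank1_free_iso:
  assumes "right_module M" "right_module N" "module_iso M N"
  shows "rank1_free M \<longleftrightarrow> rank1_free N"
  using assms by (meson module_iso_sym module_iso_trans rank1_free_def)

text \<open>\<open>R\<close> is a generator, so a universal property tested on \<open>R\<close> alone determines the module.\<close>

lemma module_iso_if_bij_on_regular_Hom:
  fixes H :: "('a::monoid_mult, 'h) rmodule" and V :: "('a, 'v) rmodule"
  assumes H: "right_module H" and V: "right_module V" and p: "p \<in> module_Hom H V"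
    and bij: "\<And>j. j \<in> module_Hom (regular_module :: ('a, 'a) rmodule) V \<Longrightarrow>
      \<exists>!k. k \<in> module_Hom (regular_module :: ('a, 'a) rmodule) H \<and> (\<forall>x. p (k x) = j x)"
  shows "module_iso H V"
proof -
  let ?R = "regular_module :: ('a, 'a) rmodule"
  \<comment> \<open>Elements of \<open>M\<close> correspond to homomorphisms out of
    \<open>R\<close>: \<open>m\<close> gives its orbit map, and evaluation at 1 recovers
    \<open>m\<close>.\<close>
  have orbit: "(\<lambda>a. act M m a) \<in> module_Hom ?R M" if "right_module M" "m \<in> elts M"
    for M :: "('a, 'm) rmodule" and m
    using that by (auto intro!: module_HomI simp: right_module_def regular_module_def)
  have unit: "act M m 1 = m" if "right_module M" "m \<in> elts M" for M :: "('a, 'm) rmodule" and m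
    using that by (simp add: right_module_def)
  have "inj_on p (elts H)"
  proof (rule inj_onI)
    fix x y assume xy: "x \<in> elts H" "y \<in> elts H" "p x = p y"
    have px: "p x \<in> elts V" using p xy by (simp add: module_Hom_mem)
    \<comment> \<open>Both orbit maps lift the orbit map of \<open>p x = p y\<close>, so uniqueness
      of lifts identifies them.\<close>
    have "(\<lambda>a. act H x a) = (\<lambda>a. act H y a)"
      using bij[OF orbit[OF V px]] orbit[OF H xy(1)] orbit[OF H xy(2)]
        module_Hom_act[OF p xy(1)] module_Hom_act[OF p xy(2)] xy(3) by auto
    then show "x = y" using unit[OF H xy(1)] unit[OF H xy(2)] by metis
  qed
  moreover have "p ` elts H = elts V"
  proof
    show "p ` elts H \<subseteq> elts V" using p by (auto simp: module_Hom_mem)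
    show "elts V \<subseteq> p ` elts H"
    proof
      fix v assume v: "v \<in> elts V"
      obtain k where k: "k \<in> module_Hom ?R H" "\<forall>x. p (k x) = act V v x"
        using bij[OF orbit[OF V v]] by blast
      have "k 1 \<in> elts H" using k(1) by (rule module_Hom_mem) (simp add: regular_module_def)
      moreover have "p (k 1) = v" using k(2) unit[OF V v] by simp
      ultimately show "v \<in> p ` elts H" by blast
    qed
  qed
  ultimately show ?thesis using p by (auto simp: module_iso_def bij_betw_def)
qed


section \<open>Right adjoints and free generators\<close>

lemma has_right_adjoint_Mon_iff_generator:
  fixes h :: "'a::monoid_mult \<Rightarrow> 'b::monoid_mult"
  assumes h: "mon_hom h"
  shows "has_right_adjoint_Mon h \<longleftrightarrow> (\<exists>e. bij (\<lambda>a. e * h a))"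
proof
  have h1: "h 1 = 1" and hm: "\<And>a b. h (a * b) = h a * h b" using h by (auto simp: mon_hom_def)
  {
    assume "has_right_adjoint_Mon h"
    then obtain u i e where "mon_hom u"
      and i: "\<And>a. i * a = u (h a) * i" and e: "\<And>b. e * h (u b) = b * e"
      and t1: "e * h i = 1" and t2: "u e * i = 1"
      by (auto simp: has_right_adjoint_Mon_def mon_adjunction_def mon_2cell_def)
    then have um: "\<And>a b. u (a * b) = u a * u b" by (auto simp: mon_hom_def)
    \<comment> \<open>The inverse is transposition along the adjunction; each triangle identity
      gives one of the two composites.\<close>
    have "bij (\<lambda>a. e * h a)"
    proof (rule o_bij[where g = "\<lambda>b. u b * i"])
      have "u (e * h a) * i = u e * i * a" for a by (simp add: um i mult.assoc)
      then show "(\<lambda>b. u b * i) \<circ> (\<lambda>a. e * h a) = id" by (simp add: fun_eq_iff t2)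
      have "e * h (u b * i) = e * h (u b) * h i" for b by (simp add: hm mult.assoc)
      also have "e * h (u b) * h i = b" for b by (simp add: e mult.assoc t1)
      finally show "(\<lambda>a. e * h a) \<circ> (\<lambda>b. u b * i) = id" by (simp add: fun_eq_iff)
    qed
    then show "\<exists>e. bij (\<lambda>a. e * h a)" ..
  next
    assume "\<exists>e. bij (\<lambda>a. e * h a)"
    then obtain e where b: "bij (\<lambda>a. e * h a)" ..
    define \<phi> where "\<phi> = inv (\<lambda>a. e * h a)"
    have \<phi>: "e * h (\<phi> b) = b" for b
      using b unfolding \<phi>_def by (meson bij_inv_eq_iff)
    have cancel: "x = y" if "e * h x = e * h y" for x y
      using b that by (auto simp: bij_def dest: injD)
    \<comment> \<open>\<open>u b\<close> solves \<open>e * h (u b) = b * e\<close> and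
      \<open>i\<close> solves \<open>e * h i = 1\<close>. These are naturality of \<open>e\<close>
      and the first triangle identity; the other laws are verified after applying the injective map
      \<open>e * h _\<close>, by \<open>cancel\<close>.\<close>
    define u i where "u b = \<phi> (b * e)" and "i = \<phi> 1" for b
    have u: "e * h (u b) = b * e" for b by (simp add: u_def \<phi>)
    have i: "e * h i = 1" by (simp add: i_def \<phi>)
    have "u 1 = 1" by (rule cancel) (simp add: u h1)
    moreover have "u (x * y) = u x * u y" for x y
    proof (rule cancel)
      have "e * h (u x * u y) = e * h (u x) * h (u y)" by (simp add: hm mult.assoc)
      also have "\<dots> = x * (e * h (u y))" by (simp add: u mult.assoc)
      finally show "e * h (u (x * y)) = e * h (u x * u y)" by (simp add: u mult.assoc)
    qed
    moreover have "i * a = u (h a) * i" for a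
    proof (rule cancel)
      have "e * h (u (h a) * i) = e * h (u (h a)) * h i" by (simp add: hm mult.assoc)
      also have "\<dots> = h a" by (simp add: u mult.assoc i)
      also have "\<dots> = e * h i * h a" by (simp add: i)
      finally show "e * h (i * a) = e * h (u (h a) * i)" by (simp add: hm mult.assoc)
    qed
    moreover have "u e * i = 1"
    proof (rule cancel)
      have "e * h (u e * i) = e * h (u e) * h i" by (simp add: hm mult.assoc)
      also have "\<dots> = e" by (simp add: u mult.assoc i)
      finally show "e * h (u e * i) = e * h 1" by (simp add: h1)
    qed
    ultimately have "mon_adjunction h u i e"
      using h u i by (simp add: mon_adjunction_def mon_2cell_def mon_hom_def)
    then show "has_right_adjoint_Mon h" by (auto simp: has_right_adjoint_Mon_def)
  }
qed

lemma rank1_free_via_iff_generator: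
  fixes h :: "'a::monoid_mult \<Rightarrow> 'a"
  assumes h: "mon_hom h"
  shows "rank1_free (via_module h) \<longleftrightarrow> (\<exists>e. bij (\<lambda>a. e * h a))"
proof -
  let ?R = "regular_module :: ('a, 'a) rmodule"
  \<comment> \<open>The isomorphism is reversed because a homomorphism out of \<open>R\<close> is
    determined by its value at 1, which will be the generator \<open>e\<close>.\<close>
  have "rank1_free (via_module h) \<longleftrightarrow> module_iso ?R (via_module h)"
  proof
    assume "rank1_free (via_module h)"
    then show "module_iso ?R (via_module h)"
      unfolding rank1_free_def by (elim conjE) (rule module_iso_sym)
  next
    assume "module_iso ?R (via_module h)"
    then show "rank1_free (via_module h)"
      unfolding rank1_free_def using right_module_via[OF h] module_iso_sym[OF right_module_regular]
      by blast
  qed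
  also have "\<dots> \<longleftrightarrow> (\<exists>e. bij (\<lambda>a. e * h a))"
  proof
    assume "module_iso ?R (via_module h)"
    then obtain f where f: "f \<in> module_Hom ?R (via_module h)" and b: "bij f"
      by (auto simp: module_iso_def)
    have "f a = f 1 * h a" for a using module_Hom_act[OF f, of 1 a] by simp
    then have "(\<lambda>a. f 1 * h a) = f" by (intro ext) (rule sym)
    with b have "bij (\<lambda>a. f 1 * h a)" by (simp only:)
    then show "\<exists>e. bij (\<lambda>a. e * h a)" ..
  next
    assume "\<exists>e. bij (\<lambda>a. e * h a)"
    then obtain e where "bij (\<lambda>a. e * h a)" ..
    moreover have "(\<lambda>a. e * h a) \<in> module_Hom ?R (via_module h)"
      using h by (intro module_HomI) (simp_all add: mon_hom_def mult.assoc)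
    ultimately show "module_iso ?R (via_module h)"
      unfolding module_iso_def by (intro bexI[of _ "\<lambda>a. e * h a"]) simp_all
  qed
  finally show ?thesis .
qed


section \<open>Identities in a skew monoidal monoid\<close>

locale skew_monoidal_monoid_loc =
  fixes \<A> :: "'a::monoid_mult smm"
  assumes smm: "skew_monoidal_monoid \<A>"
begin

abbreviation "T \<equiv> endT \<A>"
abbreviation "Q \<equiv> endQ \<A>"
abbreviation "\<gamma> \<equiv> gam \<A>"
abbreviation "\<eta> \<equiv> eta \<A>"
abbreviation "\<epsilon> \<equiv> eps \<A>"
abbreviation "\<mu> \<equiv> smm_mu \<A>"
abbreviation "\<delta> \<equiv> smm_delta \<A>"
abbreviation "S \<equiv> smm_S \<A>"
abbreviation "G \<equiv> smm_G \<A>"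
abbreviation "R \<equiv> (regular_module :: ('a, 'a) rmodule)"

lemma hom_T: "mon_hom T" and hom_Q: "mon_hom Q"
  using smm by (auto simp: skew_monoidal_monoid_def Let_def)

lemma T_1 [simp]: "T 1 = 1" and Q_1 [simp]: "Q 1 = 1"
  and T_mult: "T (a * b) = T a * T b" and Q_mult: "Q (a * b) = Q a * Q b"
  using hom_T hom_Q by (auto simp: mon_hom_def)

lemma
  shows T_Q: "T a * Q b = Q b * T a"
    and gam_TT: "\<gamma> * T (T a) = T a * \<gamma>"
    and gam_TQ: "\<gamma> * T (Q a) = Q (T a) * \<gamma>"
    and gam_Q: "\<gamma> * Q a = Q (Q a) * \<gamma>"
    and eta_nat: "\<eta> * a = T a * \<eta>"
    and eps_nat: "a * \<epsilon> = \<epsilon> * Q a"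
    and pentagon: "Q \<gamma> * \<gamma> * T \<gamma> = \<gamma> * \<gamma>"
    and gam_eta: "\<gamma> * \<eta> = Q \<eta>"
    and eps_gam: "\<epsilon> * \<gamma> = T \<epsilon>"
    and eps_eta: "\<epsilon> * \<eta> = 1"
  using smm by (auto simp: skew_monoidal_monoid_def Let_def)

section \<open>The monad \<open>T\<close> with multiplication \<open>\<mu>\<close> and unit
  \<open>\<eta>\<close>\<close>

lemma mu_T_eta [simp]: "\<mu> * T \<eta> = 1"
  using smm by (auto simp: skew_monoidal_monoid_def Let_def smm_mu_def)

lemma T_mu: "T a * \<mu> = \<mu> * T (T a)"
  unfolding smm_mu_def by (metis T_Q gam_TT mult.assoc)

lemma mu_eta [simp]: "\<mu> * \<eta> = 1"
  unfolding smm_mu_def by (metis gam_eta eps_eta Q_1 Q_mult mult.assoc)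

lemma mu_T_mult_eta: "\<mu> * T a * \<eta> = a"
  by (metis eta_nat mu_eta mult.assoc mult_1)

text \<open>Moving \<open>Q a\<close> left across \<open>\<gamma>\<close> gives
  \<open>Q (Q a)\<close>, which naturality of \<open>\<epsilon>\<close> turns into
  \<open>Q a\<close> in front; what remains is \<open>Q (\<epsilon> * \<eta>) = 1\<close>.\<close>

lemma mu_Q_eta: "\<mu> * Q a * \<eta> = Q a"
proof -
  have "\<mu> * Q a * \<eta> = Q \<epsilon> * (\<gamma> * Q a) * \<eta>" by (simp add: smm_mu_def mult.assoc)
  also have "\<dots> = Q (\<epsilon> * Q a) * (\<gamma> * \<eta>)" by (simp add: gam_Q Q_mult mult.assoc)
  also have "\<dots> = Q (a * (\<epsilon> * \<eta>))" by (simp add: gam_eta eps_nat[symmetric] Q_mult mult.assoc)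
  finally show ?thesis by (simp add: eps_eta)
qed

text \<open>Associativity of the monad, obtained from the pentagon law for
  \<open>\<gamma>\<close>.\<close>

lemma mu_mu: "\<mu> * \<mu> = \<mu> * T \<mu>"
proof -
  have "\<mu> * \<mu> = Q \<epsilon> * (\<gamma> * Q \<epsilon>) * \<gamma>" by (simp add: smm_mu_def mult.assoc)
  also have "\<dots> = Q (\<epsilon> * Q \<epsilon>) * (\<gamma> * \<gamma>)" by (simp add: gam_Q Q_mult mult.assoc)
  also have "\<dots> = Q (\<epsilon> * \<epsilon>) * (Q \<gamma> * \<gamma> * T \<gamma>)" by (simp add: eps_nat[symmetric] pentagon)
  also have "\<dots> = Q \<epsilon> * Q (\<epsilon> * \<gamma>) * \<gamma> * T \<gamma>" by (simp add: Q_mult mult.assoc)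
  also have "\<dots> = Q \<epsilon> * (\<gamma> * T (Q \<epsilon>)) * T \<gamma>" by (simp add: eps_gam gam_TQ mult.assoc)
  also have "\<dots> = \<mu> * T \<mu>" by (simp add: smm_mu_def T_mult mult.assoc)
  finally show ?thesis .
qed

text \<open>Under \<open>c \<mapsto> \<mu> * T c\<close> the product of \<open>A\<close> restricted
  to \<open>G\<close> is Kleisli composition for the monad \<open>T\<close>.\<close>

lemma mu_T_mu_T: "\<mu> * T a * (\<mu> * T b) = \<mu> * T (\<mu> * T a * b)"
proof -
  have "\<mu> * T a * (\<mu> * T b) = \<mu> * (T a * \<mu>) * T b" by (simp add: mult.assoc)
  also have "\<dots> = \<mu> * \<mu> * T (T a) * T b" by (simp add: T_mu mult.assoc)
  also have "\<dots> = \<mu> * T (\<mu> * T a * b)" by (simp add: mu_mu T_mult mult.assoc)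
  finally show ?thesis .
qed

lemma S_eq: "S a = \<mu> * T (Q a * \<eta>)"
  by (simp add: smm_S_def)

lemma S_1 [simp]: "S 1 = 1"
  by (simp add: S_eq)

text \<open>Both sides lie in \<open>G\<close>, and their Kleisli representatives agree because
  \<open>T a * Q b * \<eta> = Q b * \<eta> * a\<close>.\<close>

lemma T_S: "T a * S b = S b * T a"
proof -
  have "T a * S b = \<mu> * T (T a * Q b * \<eta>)"
    by (simp add: S_eq T_mult T_mu mult.assoc[symmetric])
  also have "T a * Q b * \<eta> = Q b * \<eta> * a" by (simp add: T_Q eta_nat mult.assoc)
  finally show ?thesis by (simp add: S_eq T_mult mult.assoc)
qed

section \<open>The submonoid \<open>G\<close>\<close>

lemma smm_G_iff: "g \<in> G \<longleftrightarrow> (\<exists>c. g = \<mu> * T c)"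
  by (auto simp: smm_G_def)

lemma smm_G_eq: "g \<in> G \<Longrightarrow> g = \<mu> * T (g * \<eta>)"
  using mu_T_mult_eta by (auto simp: smm_G_iff)

lemma mu_in_G [simp]: "\<mu> \<in> G"
  unfolding smm_G_iff by (rule exI[of _ 1]) simp

lemma S_in_G: "S a \<in> G"
  by (auto simp: S_eq smm_G_iff)

lemma G_mult: "g \<in> G \<Longrightarrow> g' \<in> G \<Longrightarrow> g * g' \<in> G"
  using mu_T_mu_T by (auto simp: smm_G_iff)

lemma G_mult_T: "g \<in> G \<Longrightarrow> g * T a \<in> G"
  unfolding smm_G_iff by (metis T_mult mult.assoc)

lemma T_mult_G: "g \<in> G \<Longrightarrow> T a * g \<in> G"
  unfolding smm_G_iff by (metis T_mu T_mult mult.assoc)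

text \<open>For \<open>g = \<mu> * T c\<close> both sides equal \<open>Q m * c\<close>. So under the
  identification of \<open>G\<close> with \<open>A\<close> by \<open>g \<mapsto> g * \<eta>\<close>,
  right multiplication by \<open>S m\<close> becomes left multiplication by
  \<open>Q m\<close>.\<close>

lemma G_S_eta:
  assumes "g \<in> G" shows "g * S m * \<eta> = Q m * g * \<eta>"
proof -
  obtain c where g: "g = \<mu> * T c" using assms by (auto simp: smm_G_iff)
  have "g * S m * \<eta> = \<mu> * T (\<mu> * T c * (Q m * \<eta>)) * \<eta>" by (simp add: g S_eq mu_T_mu_T)
  also have "\<dots> = \<mu> * (T c * Q m) * \<eta>" by (simp only: mu_T_mult_eta) (simp add: mult.assoc)
  also have "\<dots> = \<mu> * Q m * (T c * \<eta>)" by (simp add: T_Q mult.assoc)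
  also have "\<dots> = \<mu> * Q m * \<eta> * c" by (simp add: eta_nat mult.assoc)
  also have "\<dots> = Q m * c" by (simp add: mu_Q_eta)
  also have "\<dots> = Q m * (g * \<eta>)" by (simp add: g mu_T_mult_eta)
  finally show ?thesis by (simp add: mult.assoc)
qed

lemma mu_S: "\<mu> * S b = \<mu> * T (Q b)"
  using mu_T_mu_T[of 1 "Q b * \<eta>"] mu_Q_eta[of b] by (simp add: S_eq mult.assoc)

section \<open>The comonad \<open>Q\<close> with comultiplication \<open>\<delta>\<close> and counit
  \<open>\<epsilon>\<close>, and products in \<open>F\<close>\<close>

lemma eps_Q_delta: "\<epsilon> * (Q b * \<delta>) = b"
proof -
  have "\<epsilon> * (Q b * \<delta>) = b * (\<epsilon> * \<gamma>) * T \<eta>"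
    by (simp add: smm_delta_def eps_nat mult.assoc[symmetric])
  also have "\<dots> = b * T (\<epsilon> * \<eta>)" by (simp add: eps_gam T_mult mult.assoc)
  finally show ?thesis by (simp add: eps_eta)
qed

lemma delta_Q: "\<delta> * Q b = Q (Q b) * \<delta>"
  unfolding smm_delta_def by (metis T_Q gam_Q mult.assoc)

text \<open>Coassociativity of the comonad, dual to \<open>mu_mu\<close>.\<close>

lemma delta_delta: "\<delta> * \<delta> = Q \<delta> * \<delta>"
proof -
  have "Q \<delta> * \<delta> = Q \<gamma> * (Q (T \<eta>) * \<gamma>) * T \<eta>" by (simp add: smm_delta_def Q_mult mult.assoc)
  also have "\<dots> = Q \<gamma> * \<gamma> * T (Q \<eta>) * T \<eta>" by (simp add: gam_TQ[symmetric] mult.assoc)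
  \<comment> \<open>Reading \<open>Q \<eta>\<close> as \<open>\<gamma> * \<eta>\<close> creates the
    factor \<open>T \<gamma>\<close> that the pentagon law consumes.\<close>
  also have "\<dots> = Q \<gamma> * \<gamma> * T \<gamma> * T (\<eta> * \<eta>)"
    by (simp add: gam_eta[symmetric] T_mult mult.assoc)
  also have "\<dots> = \<gamma> * (\<gamma> * T (T \<eta>)) * T \<eta>"
    by (simp only: pentagon eta_nat) (simp add: T_mult mult.assoc)
  also have "\<dots> = \<delta> * \<delta>" by (simp add: gam_TT smm_delta_def mult.assoc)
  finally show ?thesis by simp
qed

lemma eps_T_delta: "\<epsilon> * T a * \<delta> = T a"
proof -
  have "\<epsilon> * T a * \<delta> = \<epsilon> * (T a * \<gamma>) * T \<eta>" by (simp add: smm_delta_def mult.assoc)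
  also have "\<dots> = \<epsilon> * \<gamma> * T (T a) * T \<eta>" by (simp add: gam_TT mult.assoc)
  also have "\<dots> = T (\<epsilon> * (T a * \<eta>))" by (simp add: eps_gam T_mult mult.assoc)
  also have "\<dots> = T (\<epsilon> * \<eta> * a)" by (simp add: eta_nat mult.assoc)
  finally show ?thesis by (simp add: eps_eta)
qed

text \<open>This is linearity of \<open>b \<mapsto> Q b * \<delta>\<close> from
  \<open>via_module T\<close> to \<open>F_module\<close>. The first two steps rewrite
  \<open>S a\<close> as the element \<open>Q (\<epsilon> * T a) * \<delta>\<close> of
  \<open>F\<close>; the comonad laws then compute the product.\<close>

lemma S_Q_delta: "S a * (Q b * \<delta>) = Q (b * T a) * \<delta>"
proof -
  have "S a = Q \<epsilon> * (\<gamma> * T (Q a)) * T \<eta>" by (simp add: S_eq smm_mu_def T_mult mult.assoc)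
  also have "\<dots> = Q (\<epsilon> * T a) * \<delta>" by (simp add: gam_TQ smm_delta_def Q_mult mult.assoc)
  finally have "S a * (Q b * \<delta>) = Q (\<epsilon> * T a) * (\<delta> * Q b) * \<delta>" by (simp add: mult.assoc)
  also have "\<dots> = Q (\<epsilon> * (T a * Q b)) * (\<delta> * \<delta>)" by (simp add: delta_Q Q_mult mult.assoc)
  also have "\<dots> = Q (\<epsilon> * Q b * T a * \<delta>) * \<delta>"
    by (simp add: T_Q delta_delta Q_mult mult.assoc)
  also have "\<epsilon> * Q b * T a * \<delta> = b * T a"
    using eps_T_delta[of a] by (simp add: eps_nat[symmetric] mult.assoc)
  finally show ?thesis .
qed


section \<open>The modules F and G\<close>

lemma module_iso_G: "module_iso (via_module Q) (G_module \<A>)"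
proof -
  have "(\<lambda>b. \<mu> * T b) \<in> module_Hom (via_module Q) (G_module \<A>)"
    by (rule module_HomI) (auto simp: via_module_def G_module_def smm_G_iff T_mult mult.assoc)
  moreover have "bij_betw (\<lambda>b. \<mu> * T b) UNIV G"
    by (rule bij_betw_byWitness[where f' = "\<lambda>g. g * \<eta>"])
      (auto simp: smm_G_iff mu_T_mult_eta)
  ultimately show ?thesis by (auto simp: module_iso_def via_module_def G_module_def)
qed

lemma module_iso_F: "module_iso (via_module T) (F_module \<A>)"
proof -
  have "(\<lambda>b. Q b * \<delta>) \<in> module_Hom (via_module T) (F_module \<A>)"
    by (rule module_HomI) (auto simp: via_module_def F_module_def smm_F_def S_Q_delta)
  moreover have "bij_betw (\<lambda>b. Q b * \<delta>) UNIV (smm_F \<A>)"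
    by (rule bij_betw_byWitness[where f' = "\<lambda>f. \<epsilon> * f"])
      (auto simp: smm_F_def eps_Q_delta)
  ultimately show ?thesis by (auto simp: module_iso_def via_module_def F_module_def)
qed


section \<open>The skew monoidal product of modules\<close>

lemma class_resp:
  assumes "\<And>p q. tensor_step \<A> M N p q \<Longrightarrow> \<phi> p = \<phi> q" and "q \<in> tensor_class \<A> M N p"
  shows "\<phi> q = \<phi> p"
proof -
  have "equivclp (tensor_step \<A> M N) p q" using assms(2) by (simp add: tensor_class_def)
  then show ?thesis by (induction rule: equivclp_induct) (auto dest: assms(1))
qed

lemma class_self: "p \<in> tensor_class \<A> M N p"
  by (simp add: tensor_class_def)

text \<open>Collapses the unions in \<open>tensor\<close> and \<open>tensor_map\<close> to the
  contribution of a single representative.\<close>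

lemma class_Union_resp:
  assumes "\<And>p q. tensor_step \<A> M N p q \<Longrightarrow> \<phi> p = \<phi> q"
  shows "(\<Union>q\<in>tensor_class \<A> M N p. \<phi> q) = \<phi> p"
  by (rule UN_constant_eq[OF class_self]) (intro ballI class_resp[of M N \<phi>, OF assms])

lemma class_eq_if_step:
  assumes "tensor_step \<A> M N p q"
  shows "tensor_class \<A> M N p = tensor_class \<A> M N q"
proof -
  have "equivclp (tensor_step \<A> M N) p q" using assms by (rule r_into_equivclp)
  then show ?thesis
    unfolding tensor_class_def by (intro Collect_cong iffI) 
      (erule (1) equivclp_trans[OF equivclp_sym], erule (1) equivclp_trans)
qed

lemma class_balanced:
  assumes "m \<in> elts M" "n \<in> elts N" "g \<in> G"
  shows "tensor_class \<A> M N (act M m b, act N n a, g) = tensor_class \<A> M N (m, n, T a * g * S b)"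
  by (rule class_eq_if_step) (rule tensor_step.intros[OF assms])

lemma class_mem_tensor:
  assumes "m \<in> elts M" "n \<in> elts N" "g \<in> G"
  shows "tensor_class \<A> M N (m, n, g) \<in> elts (tensor \<A> M N)"
  using assms by (auto simp: tensor_def)

lemma tensor_cases:
  assumes "c \<in> elts (tensor \<A> M N)"
  obtains m n g where "m \<in> elts M" "n \<in> elts N" "g \<in> G" "c = tensor_class \<A> M N (m, n, g)"
  using assms by (auto simp: tensor_def)

text \<open>Independence of the representative rests on \<open>T_S\<close>: the new factor
  \<open>T a\<close> must pass the factor \<open>S b\<close> of a step.\<close>

lemma tensor_act:
  "act (tensor \<A> M N) (tensor_class \<A> M N (m, n, g)) a = tensor_class \<A> M N (m, n, g * T a)"
proof -
  let ?\<phi> = "\<lambda>(m, n, g). tensor_class \<A> M N (m, n, g * T a)"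
  have "?\<phi> p = ?\<phi> q" if "tensor_step \<A> M N p q" for p q
    using that
  proof cases
    case (1 m n g b c)
    then show ?thesis
      using class_balanced[OF 1(3,4) G_mult_T[OF 1(5)], of b c a] by (simp add: T_S mult.assoc)
  qed
  from class_Union_resp[of M N ?\<phi>, OF this] show ?thesis by (simp add: tensor_def)
qed

lemma tensor_map_class:
  assumes "m \<in> elts M" "n \<in> elts N" "g \<in> G"
    and p: "p \<in> module_Hom M M'" and q: "q \<in> module_Hom N N'"
  shows "tensor_map \<A> M N M' N' p q (tensor_class \<A> M N (m, n, g)) =
    tensor_class \<A> M' N' (p m, q n, g)"
proof -
  let ?\<phi> = "\<lambda>(m, n, g). tensor_class \<A> M' N' (p m, q n, g)"
  have "?\<phi> x = ?\<phi> y" if "tensor_step \<A> M N x y" for x y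
    using that
  proof cases
    case (1 m n g b c)
    then show ?thesis
      using class_balanced[OF module_Hom_mem[OF p 1(3)] module_Hom_mem[OF q 1(4)] 1(5)]
      by (simp add: module_Hom_act[OF p] module_Hom_act[OF q])
  qed
  from class_Union_resp[of M N ?\<phi>, OF this] class_mem_tensor[OF assms(1-3)] show ?thesis
    by (simp add: tensor_map_def)
qed

text \<open>The universal property of the quotient: a balanced function of triples that respects the
  action induces a homomorphism.\<close>

lemma tensor_lift:
  assumes mem: "\<And>m n g. m \<in> elts M \<Longrightarrow> n \<in> elts N \<Longrightarrow> g \<in> G \<Longrightarrow> \<phi> m n g \<in> elts P"
    and bal: "\<And>m n g a b. m \<in> elts M \<Longrightarrow> n \<in> elts N \<Longrightarrow> g \<in> G \<Longrightarrow>
      \<phi> (act M m b) (act N n a) g = \<phi> m n (T a * g * S b)"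
    and act: "\<And>m n g a. m \<in> elts M \<Longrightarrow> n \<in> elts N \<Longrightarrow> g \<in> G \<Longrightarrow>
      \<phi> m n (g * T a) = act P (\<phi> m n g) a"
  obtains f where "f \<in> module_Hom (tensor \<A> M N) P"
    and "\<And>m n g. m \<in> elts M \<Longrightarrow> n \<in> elts N \<Longrightarrow> g \<in> G \<Longrightarrow>
      f (tensor_class \<A> M N (m, n, g)) = \<phi> m n g"
proof -
  let ?\<psi> = "\<lambda>(m, n, g). \<phi> m n g"
  let ?f = "\<lambda>c\<in>elts (tensor \<A> M N). ?\<psi> (SOME p. p \<in> c)"
  have resp: "?\<psi> p = ?\<psi> q" if "tensor_step \<A> M N p q" for p q
    using that by cases (simp add: bal)
  have f: "?f (tensor_class \<A> M N (m, n, g)) = \<phi> m n g"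
    if "m \<in> elts M" "n \<in> elts N" "g \<in> G" for m n g
    using class_resp[of M N ?\<psi>, OF resp someI[of "\<lambda>p. p \<in> tensor_class \<A> M N (m, n, g)", OF class_self]]
      class_mem_tensor[OF that] by simp
  moreover have "?f \<in> module_Hom (tensor \<A> M N) P"
  proof (rule module_HomI)
    fix c a assume "c \<in> elts (tensor \<A> M N)"
    then obtain m n g where c: "m \<in> elts M" "n \<in> elts N" "g \<in> G" "c = tensor_class \<A> M N (m, n, g)"
      by (rule tensor_cases)
    show "?f c \<in> elts P" unfolding c(4) f[OF c(1-3)] by (rule mem[OF c(1-3)])
    show "?f (act (tensor \<A> M N) c a) = act P (?f c) a"
      unfolding c(4) tensor_act f[OF c(1-3)] f[OF c(1,2) G_mult_T[OF c(3)]]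
      by (rule act[OF c(1-3)])
  qed simp
  ultimately show thesis using that by blast
qed

lemma tensor_Hom_act:
  assumes "f \<in> module_Hom (tensor \<A> M N) P" "m \<in> elts M" "n \<in> elts N" "g \<in> G"
  shows "f (tensor_class \<A> M N (m, n, g * T a)) = act P (f (tensor_class \<A> M N (m, n, g))) a"
  using module_Hom_act[OF assms(1) class_mem_tensor[OF assms(2-4)]] by (simp add: tensor_act)


section \<open>The right internal hom\<close>

text \<open>The third entry is \<open>\<mu>\<close> because it generates \<open>G\<close> under
  right multiplication by \<open>T(A)\<close>; these values therefore determine
  \<open>f\<close>.\<close>

definition curry_right where
  "curry_right X f = (\<lambda>x\<in>elts X. f (tensor_class \<A> R X (1, x, \<mu>)))"

text \<open>The action goes through \<open>T\<close> because \<open>[1, x \<cdot> a, \<mu>] =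
  [1, x, T a * \<mu>] = [1, x, \<mu>] \<cdot> T a\<close>, by \<open>T_mu\<close>.\<close>

lemma curry_right_Hom:
  assumes X: "right_module X" and f: "f \<in> module_Hom (tensor \<A> R X) R"
  shows "curry_right X f \<in> module_Hom X (via_module T)"
proof (rule module_HomI)
  fix x a assume x: "x \<in> elts X"
  have "tensor_class \<A> R X (1, act X x a, \<mu>) = tensor_class \<A> R X (1, x, \<mu> * T (T a))"
    using class_balanced[of 1 R x X \<mu> 1 a] x by (simp add: T_mu)
  then show "curry_right X f (act X x a) = act (via_module T) (curry_right X f x) a"
    using tensor_Hom_act[OF f _ x mu_in_G] x right_module_act_mem[OF X x]
    by (simp add: curry_right_def)
qed (auto simp: curry_right_def)

text \<open>Balancing moves \<open>m\<close> into \<open>g * S m\<close>, an element of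
  \<open>G\<close> and so \<open>\<mu> * T (g * S m * \<eta>)\<close>; the factor after
  \<open>\<mu>\<close> acts on \<open>[1, x, \<mu>]\<close>, and \<open>G_S_eta\<close> rewrites the
  result.\<close>

lemma right_Hom_eq:
  assumes X: "right_module X" and f: "f \<in> module_Hom (tensor \<A> R X) R"
    and x: "x \<in> elts X" and g: "g \<in> G"
  shows "f (tensor_class \<A> R X (m, x, g)) = curry_right X f x * Q m * g * \<eta>"
proof -
  have gS: "g * S m \<in> G" using g S_in_G by (rule G_mult)
  have "tensor_class \<A> R X (m, x, g) = tensor_class \<A> R X (1, x, g * S m)"
    using class_balanced[of 1 R x X g m 1] X x g by (simp add: right_module_def)
  also have "\<dots> = tensor_class \<A> R X (1, x, \<mu> * T (g * S m * \<eta>))"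
    using smm_G_eq[OF gS] by simp
  finally have "f (tensor_class \<A> R X (m, x, g)) = curry_right X f x * (g * S m * \<eta>)"
    using tensor_Hom_act[OF f _ x mu_in_G] x by (simp add: curry_right_def)
  then show ?thesis by (simp only: G_S_eta[OF g]) (simp add: mult.assoc)
qed

lemma right_Hom_eqI:
  assumes X: "right_module X"
    and f: "f \<in> module_Hom (tensor \<A> R X) R" and f': "f' \<in> module_Hom (tensor \<A> R X) R"
    and eq: "\<And>x. x \<in> elts X \<Longrightarrow> curry_right X f x = curry_right X f' x"
  shows "f = f'"
proof (rule module_Hom_eqI[OF f f'])
  fix c assume "c \<in> elts (tensor \<A> R X)"
  then obtain m x g where "x \<in> elts X" "g \<in> G" "c = tensor_class \<A> R X (m, x, g)"
    by (rule tensor_cases)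
  then show "f c = f' c" by (simp add: right_Hom_eq[OF X f] right_Hom_eq[OF X f'] eq)
qed

lemma right_Hom_exists:
  assumes k: "k \<in> module_Hom X (via_module T)"
  obtains f where "f \<in> module_Hom (tensor \<A> R X) R"
    and "\<And>x. x \<in> elts X \<Longrightarrow> curry_right X f x = k x"
proof -
  obtain f where f: "f \<in> module_Hom (tensor \<A> R X) R"
    and f_class: "\<And>m x g. m \<in> elts R \<Longrightarrow> x \<in> elts X \<Longrightarrow> g \<in> G \<Longrightarrow>
      f (tensor_class \<A> R X (m, x, g)) = k x * (g * S m * \<eta>)"
  \<comment> \<open>By \<open>G_S_eta\<close> this is the value forced by
    \<open>right_Hom_eq\<close>.\<close>
  proof (rule tensor_lift[where M = R and N = X and P = R and \<phi> = "\<lambda>m x g. k x * (g * S m * \<eta>)"])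
    fix m x g a b assume x: "x \<in> elts X" and g: "g \<in> G"
    have "g * S (m * b) * \<eta> = Q m * Q b * g * \<eta>" by (simp only: G_S_eta[OF g] Q_mult mult.assoc[symmetric])
    \<comment> \<open>\<open>G_S_eta\<close> is used for \<open>S m\<close> and then for
      \<open>S b\<close>, so these factors become \<open>Q m * Q b = Q (m * b)\<close> on the left,
      past \<open>T a\<close>.\<close>
    moreover have "T a * g * S b * S m * \<eta> = T a * (g * S (m * b) * \<eta>)"
    proof -
      have "T a * g * S b * S m * \<eta> = Q m * (T a * g * S b) * \<eta>"
        by (rule G_S_eta) (intro G_mult T_mult_G g S_in_G)
      also have "\<dots> = T a * (Q m * (g * S b * \<eta>))"
        by (simp add: T_Q mult.assoc[symmetric])
      finally show ?thesis by (simp only: G_S_eta[OF g]) (simp add: Q_mult mult.assoc)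
    qed
    ultimately show "k (act X x a) * (g * S (act R m b) * \<eta>) = k x * (T a * g * S b * S m * \<eta>)"
      using module_Hom_act[OF k x] by (simp add: mult.assoc)
  next
    fix m x g a
    have "g * T a * S m * \<eta> = g * (T a * S m) * \<eta>" by (simp add: mult.assoc)
    also have "\<dots> = g * S m * \<eta> * a" by (simp add: T_S eta_nat mult.assoc)
    finally have "g * T a * S m * \<eta> = g * S m * \<eta> * a" .
    then show "k x * (g * T a * S m * \<eta>) = act R (k x * (g * S m * \<eta>)) a" by (simp add: mult.assoc)
  qed auto
  \<comment> \<open>At \<open>m = 1\<close> and \<open>g = \<mu>\<close> the second factor is
    \<open>\<mu> * S 1 * \<eta> = 1\<close>.\<close>
  from f f_class show thesis by (intro that[of f]) (auto simp: curry_right_def)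
qed

text \<open>Naturality of currying in \<open>X\<close>.\<close>

lemma curry_right_compose:
  assumes H: "right_module H" and ev: "ev \<in> module_Hom (tensor \<A> R H) R"
    and X: "right_module X" and k: "k \<in> module_Hom X H"
  defines "f \<equiv> compose (elts (tensor \<A> R X)) ev (tensor_map \<A> R X R H (module_id R) k)"
  shows "f \<in> module_Hom (tensor \<A> R X) R"
    and "x \<in> elts X \<Longrightarrow> curry_right X f x = curry_right H ev (k x)"
proof -
  have f: "f (tensor_class \<A> R X (m, x, g)) = ev (tensor_class \<A> R H (m, k x, g))"
    if "x \<in> elts X" "g \<in> G" for m x g
    using that tensor_map_class[OF _ that module_id_Hom[OF right_module_regular] k]
    by (simp add: f_def compose_def class_mem_tensor)
  show "f \<in> module_Hom (tensor \<A> R X) R"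
  proof (rule module_HomI)
    fix c a assume "c \<in> elts (tensor \<A> R X)"
    then obtain m x g where "x \<in> elts X" "g \<in> G" "c = tensor_class \<A> R X (m, x, g)"
      by (rule tensor_cases)
    then show "f (act (tensor \<A> R X) c a) = act R (f c) a"
      using tensor_Hom_act[OF ev _ module_Hom_mem[OF k]] by (simp add: tensor_act f G_mult_T)
  qed (auto simp: f_def compose_def)
  show "x \<in> elts X \<Longrightarrow> curry_right X f x = curry_right H ev (k x)"
    using module_Hom_mem[OF k] by (simp add: curry_right_def f)
qed

text \<open>Currying is injective and natural, so factoring \<open>f\<close> through
  \<open>ev\<close> becomes a pointwise equation with no tensor product in it.\<close>

lemma right_factor_iff:
  assumes H: "right_module H" and ev: "ev \<in> module_Hom (tensor \<A> R H) R"
    and X: "right_module X" and k: "k \<in> module_Hom X H" and f: "f \<in> module_Hom (tensor \<A> R X) R"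
  shows "compose (elts (tensor \<A> R X)) ev (tensor_map \<A> R X R H (module_id R) k) = f \<longleftrightarrow>
    (\<forall>x\<in>elts X. curry_right H ev (k x) = curry_right X f x)"
  using curry_right_compose[OF H ev X k] right_Hom_eqI[OF X _ f] by metis

lemma right_internal_hom_via: "\<exists>ev. is_right_internal_hom TYPE('x) \<A> R R (via_module T) ev"
proof -
  let ?V = "via_module T"
  note V = right_module_via[OF hom_T]
  \<comment> \<open>\<open>ev\<close> is the homomorphism that curries to the identity, so the
    factorization condition reads \<open>k x = curry_right X f x\<close>.\<close>
  obtain ev where ev: "ev \<in> module_Hom (tensor \<A> R ?V) R"
    and c: "\<And>x. curry_right ?V ev x = x"
    using right_Hom_exists[OF module_id_Hom[OF V]] by auto
  have "\<exists>!k. k \<in> module_Hom X ?V \<and>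
      compose (elts (tensor \<A> R X)) ev (tensor_map \<A> R X R ?V (module_id R) k) = f"
    if X: "right_module X" and f: "f \<in> module_Hom (tensor \<A> R X) R" for X :: "('a, 'x) rmodule" and f
  proof (rule ex1I[of _ "curry_right X f"], rule conjI)
    show cf: "curry_right X f \<in> module_Hom X ?V" by (rule curry_right_Hom[OF X f])
    show "compose (elts (tensor \<A> R X)) ev (tensor_map \<A> R X R ?V (module_id R) (curry_right X f)) = f"
      using right_factor_iff[OF V ev X cf f] c by simp
    fix k assume "k \<in> module_Hom X ?V \<and>
      compose (elts (tensor \<A> R X)) ev (tensor_map \<A> R X R ?V (module_id R) k) = f"
    then show "k = curry_right X f"
      using right_factor_iff[OF V ev X _ f] c by (intro module_Hom_eqI[OF _ cf]) auto
  qed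
  then show ?thesis using V ev unfolding is_right_internal_hom_def by blast
qed

text \<open>The curried evaluation is the comparison map from \<open>H\<close> to
  \<open>via_module T\<close>; the universal property at \<open>X = R\<close> makes it bijective,
  since \<open>R\<close> is a generator.\<close>

lemma right_internal_hom_iso:
  assumes hom: "is_right_internal_hom TYPE('a) \<A> R R H ev"
  shows "module_iso H (via_module T)"
proof -
  have H: "right_module H" and ev: "ev \<in> module_Hom (tensor \<A> R H) R"
    and univ: "\<And>f. f \<in> module_Hom (tensor \<A> R R) R \<Longrightarrow> \<exists>!k. k \<in> module_Hom R H \<and>
      compose (elts (tensor \<A> R R)) ev (tensor_map \<A> R R R H (module_id R) k) = f"
    using hom right_module_regular unfolding is_right_internal_hom_def by blast+
  show ?thesis
  proof (rule module_iso_if_bij_on_regular_Hom[OF H right_module_via[OF hom_T] curry_right_Hom[OF H ev]])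
    fix j assume "j \<in> module_Hom R (via_module T)"
    then obtain f where f: "f \<in> module_Hom (tensor \<A> R R) R" and c: "\<And>x. curry_right R f x = j x"
      using right_Hom_exists by (metis UNIV_I regular_module_simps(1))
    show "\<exists>!k. k \<in> module_Hom R H \<and> (\<forall>x. curry_right H ev (k x) = j x)"
      using univ[OF f] right_factor_iff[OF H ev right_module_regular _ f] c
      by (simp cong: conj_cong)
  qed
qed


section \<open>The left internal hom\<close>

definition curry_left where
  "curry_left X f = (\<lambda>x\<in>elts X. f (tensor_class \<A> X R (x, 1, \<mu>)))"

text \<open>Here balancing produces \<open>\<mu> * S a\<close>, which \<open>mu_S\<close> turns into
  \<open>\<mu> * T (Q a)\<close>; hence the action through \<open>Q\<close>.\<close>

lemma curry_left_Hom:
  assumes X: "right_module X" and f: "f \<in> module_Hom (tensor \<A> X R) R"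
  shows "curry_left X f \<in> module_Hom X (via_module Q)"
proof (rule module_HomI)
  fix x a assume x: "x \<in> elts X"
  have "tensor_class \<A> X R (act X x a, 1, \<mu>) = tensor_class \<A> X R (x, 1, \<mu> * T (Q a))"
    using class_balanced[of x X 1 R \<mu> a 1] x by (simp add: mu_S)
  then show "curry_left X f (act X x a) = act (via_module Q) (curry_left X f x) a"
    using tensor_Hom_act[OF f x _ mu_in_G] x right_module_act_mem[OF X x]
    by (simp add: curry_left_def)
qed (auto simp: curry_left_def)

text \<open>In the second slot \<open>m\<close> moves to \<open>T m\<close> on the left of
  \<open>g\<close>, so the formula needs no conversion of \<open>S\<close>.\<close>

lemma left_Hom_eq:
  assumes X: "right_module X" and f: "f \<in> module_Hom (tensor \<A> X R) R"
    and x: "x \<in> elts X" and g: "g \<in> G"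
  shows "f (tensor_class \<A> X R (x, m, g)) = curry_left X f x * T m * g * \<eta>"
proof -
  have Tg: "T m * g \<in> G" using g by (rule T_mult_G)
  have "tensor_class \<A> X R (x, m, g) = tensor_class \<A> X R (x, 1, T m * g)"
    using class_balanced[of x X 1 R g 1 m] X x g by (simp add: right_module_def)
  also have "\<dots> = tensor_class \<A> X R (x, 1, \<mu> * T (T m * g * \<eta>))"
    using smm_G_eq[OF Tg] by simp
  finally show ?thesis
    using tensor_Hom_act[OF f x _ mu_in_G] x by (simp add: curry_left_def mult.assoc)
qed

lemma left_Hom_eqI:
  assumes X: "right_module X"
    and f: "f \<in> module_Hom (tensor \<A> X R) R" and f': "f' \<in> module_Hom (tensor \<A> X R) R"
    and eq: "\<And>x. x \<in> elts X \<Longrightarrow> curry_left X f x = curry_left X f' x"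
  shows "f = f'"
proof (rule module_Hom_eqI[OF f f'])
  fix c assume "c \<in> elts (tensor \<A> X R)"
  then obtain m x g where "x \<in> elts X" "g \<in> G" "c = tensor_class \<A> X R (x, m, g)"
    by (rule tensor_cases)
  then show "f c = f' c" by (simp add: left_Hom_eq[OF X f] left_Hom_eq[OF X f'] eq)
qed

lemma left_Hom_exists:
  assumes k: "k \<in> module_Hom X (via_module Q)"
  obtains f where "f \<in> module_Hom (tensor \<A> X R) R"
    and "\<And>x. x \<in> elts X \<Longrightarrow> curry_left X f x = k x"
proof -
  obtain f where f: "f \<in> module_Hom (tensor \<A> X R) R"
    and f_class: "\<And>x m g. x \<in> elts X \<Longrightarrow> m \<in> elts R \<Longrightarrow> g \<in> G \<Longrightarrow>
      f (tensor_class \<A> X R (x, m, g)) = k x * (T m * g * \<eta>)"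
  proof (rule tensor_lift[where M = X and N = R and P = R and \<phi> = "\<lambda>x m g. k x * (T m * g * \<eta>)"])
    fix x m g a b assume x: "x \<in> elts X" and g: "g \<in> G"
    have "T m * (T a * g * S b) * \<eta> = T (m * a) * (g * S b * \<eta>)"
      by (simp add: T_mult mult.assoc)
    \<comment> \<open>\<open>G_S_eta\<close> turns \<open>S b\<close> into \<open>Q b\<close>, which
      commutes past \<open>T (m * a)\<close> to match
      \<open>k (act X x b) = k x * Q b\<close>.\<close>
    also have "\<dots> = Q b * (T (m * a) * g * \<eta>)"
      unfolding G_S_eta[OF g] by (simp add: T_Q mult.assoc[symmetric])
    finally show "k (act X x b) * (T (act R m a) * g * \<eta>) = k x * (T m * (T a * g * S b) * \<eta>)"
      using module_Hom_act[OF k x] by (simp add: mult.assoc)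
  qed (auto simp: eta_nat mult.assoc)
  from f f_class show thesis by (intro that[of f]) (auto simp: curry_left_def)
qed

lemma curry_left_compose:
  assumes H: "right_module H" and ev: "ev \<in> module_Hom (tensor \<A> H R) R"
    and X: "right_module X" and k: "k \<in> module_Hom X H"
  defines "f \<equiv> compose (elts (tensor \<A> X R)) ev (tensor_map \<A> X R H R k (module_id R))"
  shows "f \<in> module_Hom (tensor \<A> X R) R"
    and "x \<in> elts X \<Longrightarrow> curry_left X f x = curry_left H ev (k x)"
proof -
  have f: "f (tensor_class \<A> X R (x, m, g)) = ev (tensor_class \<A> H R (k x, m, g))"
    if "x \<in> elts X" "g \<in> G" for m x g
    using that tensor_map_class[OF that(1) _ that(2) k module_id_Hom[OF right_module_regular]]
    by (simp add: f_def compose_def class_mem_tensor)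
  show "f \<in> module_Hom (tensor \<A> X R) R"
  proof (rule module_HomI)
    fix c a assume "c \<in> elts (tensor \<A> X R)"
    then obtain x m g where "x \<in> elts X" "g \<in> G" "c = tensor_class \<A> X R (x, m, g)"
      by (rule tensor_cases)
    then show "f (act (tensor \<A> X R) c a) = act R (f c) a"
      using tensor_Hom_act[OF ev module_Hom_mem[OF k]] by (simp add: tensor_act f G_mult_T)
  qed (auto simp: f_def compose_def)
  show "x \<in> elts X \<Longrightarrow> curry_left X f x = curry_left H ev (k x)"
    using module_Hom_mem[OF k] by (simp add: curry_left_def f)
qed

lemma left_factor_iff:
  assumes H: "right_module H" and ev: "ev \<in> module_Hom (tensor \<A> H R) R"
    and X: "right_module X" and k: "k \<in> module_Hom X H" and f: "f \<in> module_Hom (tensor \<A> X R) R"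
  shows "compose (elts (tensor \<A> X R)) ev (tensor_map \<A> X R H R k (module_id R)) = f \<longleftrightarrow>
    (\<forall>x\<in>elts X. curry_left H ev (k x) = curry_left X f x)"
  using curry_left_compose[OF H ev X k] left_Hom_eqI[OF X _ f] by metis

lemma left_internal_hom_via: "\<exists>ev. is_left_internal_hom TYPE('x) \<A> R R (via_module Q) ev"
proof -
  let ?V = "via_module Q"
  note V = right_module_via[OF hom_Q]
  \<comment> \<open>Again \<open>ev\<close> is chosen to curry to the identity.\<close>
  obtain ev where ev: "ev \<in> module_Hom (tensor \<A> ?V R) R"
    and c: "\<And>x. curry_left ?V ev x = x"
    using left_Hom_exists[OF module_id_Hom[OF V]] by auto
  have "\<exists>!k. k \<in> module_Hom X ?V \<and>
      compose (elts (tensor \<A> X R)) ev (tensor_map \<A> X R ?V R k (module_id R)) = f"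
    if X: "right_module X" and f: "f \<in> module_Hom (tensor \<A> X R) R" for X :: "('a, 'x) rmodule" and f
  proof (rule ex1I[of _ "curry_left X f"], rule conjI)
    show cf: "curry_left X f \<in> module_Hom X ?V" by (rule curry_left_Hom[OF X f])
    show "compose (elts (tensor \<A> X R)) ev (tensor_map \<A> X R ?V R (curry_left X f) (module_id R)) = f"
      using left_factor_iff[OF V ev X cf f] c by simp
    fix k assume "k \<in> module_Hom X ?V \<and>
      compose (elts (tensor \<A> X R)) ev (tensor_map \<A> X R ?V R k (module_id R)) = f"
    then show "k = curry_left X f"
      using left_factor_iff[OF V ev X _ f] c by (intro module_Hom_eqI[OF _ cf]) auto
  qed
  then show ?thesis using V ev unfolding is_left_internal_hom_def by blast
qed

lemma left_internal_hom_iso: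
  assumes hom: "is_left_internal_hom TYPE('a) \<A> R R H ev"
  shows "module_iso H (via_module Q)"
proof -
  have H: "right_module H" and ev: "ev \<in> module_Hom (tensor \<A> H R) R"
    and univ: "\<And>f. f \<in> module_Hom (tensor \<A> R R) R \<Longrightarrow> \<exists>!k. k \<in> module_Hom R H \<and>
      compose (elts (tensor \<A> R R)) ev (tensor_map \<A> R R H R k (module_id R)) = f"
    using hom right_module_regular unfolding is_left_internal_hom_def by blast+
  show ?thesis
  proof (rule module_iso_if_bij_on_regular_Hom[OF H right_module_via[OF hom_Q] curry_left_Hom[OF H ev]])
    fix j assume "j \<in> module_Hom R (via_module Q)"
    then obtain f where f: "f \<in> module_Hom (tensor \<A> R R) R" and c: "\<And>x. curry_left R f x = j x"
      using left_Hom_exists by (metis UNIV_I regular_module_simps(1))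
    show "\<exists>!k. k \<in> module_Hom R H \<and> (\<forall>x. curry_left H ev (k x) = j x)"
      using univ[OF f] left_factor_iff[OF H ev right_module_regular _ f] c
      by (simp cong: conj_cong)
  qed
qed

section \<open>Closedness as rank 1 freeness\<close>

lemma closed_iff:
  shows "right_closed \<A> \<longleftrightarrow> has_right_adjoint_Mon T"
    and "left_closed \<A> \<longleftrightarrow> has_right_adjoint_Mon Q"
  by (simp_all add: right_closed_def left_closed_def skew_prod_def)

text \<open>Existence of a generator \<open>e\<close> with \<open>a \<mapsto> e * T a\<close>
  bijective links the two sides. Leaving \<open>M\<close> general covers
  \<open>via_module T\<close>, \<open>F_module\<close> and every internal hom \<open>H\<close> at
  once.\<close>

lemma right_closed_iff_rank1_free:
  assumes "right_module M" "module_iso M (via_module T)"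
  shows "right_closed \<A> \<longleftrightarrow> rank1_free M"
  using rank1_free_iso[OF assms(1) right_module_via[OF hom_T] assms(2)] closed_iff
    has_right_adjoint_Mon_iff_generator[OF hom_T] rank1_free_via_iff_generator[OF hom_T] by simp

lemma left_closed_iff_rank1_free:
  assumes "right_module M" "module_iso M (via_module Q)"
  shows "left_closed \<A> \<longleftrightarrow> rank1_free M"
  using rank1_free_iso[OF assms(1) right_module_via[OF hom_Q] assms(2)] closed_iff
    has_right_adjoint_Mon_iff_generator[OF hom_Q] rank1_free_via_iff_generator[OF hom_Q] by simp

end


section \<open>The equivalences\<close>

theorem proposition5p5:
  fixes \<A> :: "'a::monoid_mult smm"
  assumes "skew_monoidal_monoid \<A>"
  defines "R \<equiv> (regular_module :: ('a, 'a) rmodule)"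
  shows
    "((\<exists>ev. is_right_internal_hom TYPE('x) \<A> R R (via_module (endT \<A>)) ev) \<and>
      (\<forall>(H :: ('a, 'h) rmodule) ev. is_right_internal_hom TYPE('a) \<A> R R H ev \<longrightarrow>
         module_iso H (via_module (endT \<A>)) \<and>
         (right_closed \<A> \<longleftrightarrow> rank1_free H)) \<and>
      (right_closed \<A> \<longleftrightarrow> has_right_adjoint_Mon (endT \<A>)) \<and>
      (right_closed \<A> \<longleftrightarrow> rank1_free (via_module (endT \<A>))) \<and>
      (right_closed \<A> \<longleftrightarrow> rank1_free (F_module \<A>)))
     \<and>
     ((\<exists>ev. is_left_internal_hom TYPE('x) \<A> R R (via_module (endQ \<A>)) ev) \<and>
      (\<forall>(H :: ('a, 'h) rmodule) ev. is_left_internal_hom TYPE('a) \<A> R R H ev \<longrightarrow>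
         module_iso H (via_module (endQ \<A>)) \<and>
         (left_closed \<A> \<longleftrightarrow> rank1_free H)) \<and>
      (left_closed \<A> \<longleftrightarrow> has_right_adjoint_Mon (endQ \<A>)) \<and>
      (left_closed \<A> \<longleftrightarrow> rank1_free (via_module (endQ \<A>))) \<and>
      (left_closed \<A> \<longleftrightarrow> rank1_free (G_module \<A>)))"
proof -
  interpret skew_monoidal_monoid_loc \<A> using assms(1) by unfold_locales
  have VT: "right_module (via_module T)" and VQ: "right_module (via_module Q)"
    using right_module_via hom_T hom_Q by blast+
  have F: "right_closed \<A> \<longleftrightarrow> rank1_free (F_module \<A>)"
    using right_closed_iff_rank1_free right_module_iso_image[OF VT module_iso_F]
      module_iso_sym[OF VT module_iso_F] by blast
  have G: "left_closed \<A> \<longleftrightarrow> rank1_free (G_module \<A>)"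
    using left_closed_iff_rank1_free right_module_iso_image[OF VQ module_iso_G]
      module_iso_sym[OF VQ module_iso_G] by blast
  have HT: "module_iso H (via_module T) \<and> (right_closed \<A> \<longleftrightarrow> rank1_free H)"
    if "is_right_internal_hom TYPE('a) \<A> R R H ev" for H :: "('a, 'h) rmodule" and ev
    using right_internal_hom_iso right_closed_iff_rank1_free that
    unfolding R_def is_right_internal_hom_def by blast
  have HQ: "module_iso H (via_module Q) \<and> (left_closed \<A> \<longleftrightarrow> rank1_free H)"
    if "is_left_internal_hom TYPE('a) \<A> R R H ev" for H :: "('a, 'h) rmodule" and ev
    using left_internal_hom_iso left_closed_iff_rank1_free that
    unfolding R_def is_left_internal_hom_def by blast
  show ?thesis
    using right_internal_hom_via left_internal_hom_via HT HQ F G closed_iff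
      right_closed_iff_rank1_free[OF VT module_iso_refl[OF VT]] left_closed_iff_rank1_free[OF VQ module_iso_refl[OF VQ]]
    unfolding R_def by simp
qed

end
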